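(* Let $k$ and $r$ be integers with $0\le r\le k-3$. Every graph of order $n$ and size more than $\frac{(k-1)n}{2}$ contains (as a subgraph, not necessarily induced) a keyring of size at least $k$ and with $r$ leaves.
   Context: All graphs are finite, simple and undirected. The order of a graph is its number of vertices and its size is its number of edges. A vertex of a graph is a leaf if it has degree one. A keyring with $r\ge 0$ leaves is a graph obtained from a cycle (of length at least 3) by appending $r$ leaves to one of its vertices, i.e., by adding $r$ new vertices, each joined by a single edge to one and the same fixed vertex of the cycle. *)

theory Defs
  imports Complex_Main
begin

(* A graph is given by its vertex set V and its edge set E; an edge is the
   two-element set of its ends. *)

definition simple_graph :: "'a set \<Rightarrow> 'a set set \<Rightarrow> bool" where
  "simple_graph V E \<longleftrightarrow> finite V \<and> (\<forall>e\<in>E. e \<subseteq> V \<and> card e = 2)"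

definition subgraph :: "'a set \<Rightarrow> 'a set set \<Rightarrow> 'a set \<Rightarrow> 'a set set \<Rightarrow> bool" where
  "subgraph V' E' V E \<longleftrightarrow> simple_graph V' E' \<and> V' \<subseteq> V \<and> E' \<subseteq> E"

definition is_cycle :: "'a set \<Rightarrow> 'a set set \<Rightarrow> bool" where
  "is_cycle V E \<longleftrightarrow>
     (\<exists>xs. distinct xs \<and> 3 \<le> length xs \<and> V = set xs \<and>
           E = {{xs ! i, xs ! (Suc i mod length xs)} | i. i < length xs})"

definition is_keyring :: "nat \<Rightarrow> 'a set \<Rightarrow> 'a set set \<Rightarrow> bool" where
  "is_keyring r V E \<longleftrightarrow>
     (\<exists>C F v L. is_cycle C F \<and> v \<in> C \<and>
        finite L \<and> card L = r \<and> L \<inter> C = {} \<and>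
        V = C \<union> L \<and> E = F \<union> {{v, u} | u. u \<in> L})"

end

theory Submission
  imports Defs
begin

text \<open>
  Let \<open>U\<close> be a minimal nonempty vertex set with \<open>2 e(U) > (k - 1) (|U| - 1)\<close>. By minimality
  the graph induced on \<open>U\<close> has minimum degree at least \<open>k / 2\<close> and no cut vertex, and some vertex
  \<open>v\<close> has degree at least \<open>k - 1\<close>. Then \<open>v\<close> lies on a cycle of length at least \<open>k\<close>: otherwise
  \<open>v\<close> has a neighbour off a longest cycle \<open>C\<close> through \<open>v\<close>, and the component of that neighbour
  outside \<open>C\<close> contains a path of \<open>q\<close> vertices that starts next to \<open>v\<close> and whose last vertex has
  \<open>t > 0\<close> neighbours in \<open>C - v\<close> with \<open>q + t \<ge> k / 2\<close>; as rerouting \<open>C\<close> cannot make it longer,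
  \<open>|C| \<ge> 2 (q + t) \<ge> k\<close>. Finally, the shortest cycle of length at least \<open>k - r\<close> cut off from such
  a cycle by a chord at \<open>v\<close> contains at most \<open>k - r - 1\<close> neighbours of \<open>v\<close>, so \<open>r\<close> of them remain
  for the leaves.
\<close>

section \<open>Boundaries, paths and rooted cycles\<close>

definition boundary :: "('a \<Rightarrow> 'a \<Rightarrow> bool) \<Rightarrow> 'a set \<Rightarrow> 'a set \<Rightarrow> 'a set" where
  "boundary R X D = {w \<in> X - D. \<exists>u\<in>D. R u w}"

definition path_in :: "('a \<Rightarrow> 'a \<Rightarrow> bool) \<Rightarrow> 'a set \<Rightarrow> 'a list \<Rightarrow> bool" where
  "path_in R B p \<longleftrightarrow> p \<noteq> [] \<and> distinct p \<and> set p \<subseteq> B \<and> successively R p"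

text \<open>The list is rooted: a cycle through \<open>v\<close> is one with
  \<open>hd c = v\<close>, and the arcs that start or end at \<open>v\<close> become prefixes and
  suffixes of the list.\<close>

definition cyc :: "('a \<Rightarrow> 'a \<Rightarrow> bool) \<Rightarrow> 'a list \<Rightarrow> bool" where
  "cyc R c \<longleftrightarrow> distinct c \<and> 3 \<le> length c \<and> successively R c \<and> R (last c) (hd c)"

lemma path_in_append:
  assumes "path_in R B p" "path_in R B q" "set p \<inter> set q = {}" "R (last p) (hd q)"
  shows "path_in R B (p @ q)"
  using assms by (auto simp: path_in_def successively_append_iff)

lemma path_in_mono: "path_in R B p \<Longrightarrow> B \<subseteq> B' \<Longrightarrow> path_in R B' p"
  by (auto simp: path_in_def)

section \<open>Paths that leave a set, and ears\<close>

text \<open>The vertices reachable from \<open>y\<close> by paths inside \<open>A\<close> form a set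
  closed under adjacency in \<open>A\<close>; \<open>cut\<close> applied to this set provides the
  exit edge.\<close>

lemma path_to_exit:
  assumes y: "y \<in> A"
    and cut: "\<And>K. y \<in> K \<Longrightarrow> K \<subseteq> A \<Longrightarrow> (\<And>u w. u \<in> K \<Longrightarrow> w \<in> A \<Longrightarrow> R u w \<Longrightarrow> w \<in> K)
               \<Longrightarrow> \<exists>u\<in>K. \<exists>z\<in>Z. R u z"
  shows "\<exists>q. path_in R A q \<and> hd q = y \<and> (\<exists>z\<in>Z. R (last q) z)"
proof -
  define K where "K = {u. \<exists>q. path_in R A q \<and> hd q = y \<and> last q = u}"
  have "path_in R A [y]" using y by (simp add: path_in_def)
  then have yK: "y \<in> K" unfolding K_def by force
  have KA: "K \<subseteq> A" unfolding K_def path_in_def using last_in_set by fastforce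
  have "w \<in> K" if u: "u \<in> K" and w: "w \<in> A" and r: "R u w" for u w
  proof -
    obtain q where q: "path_in R A q" "hd q = y" "last q = u" using u K_def by blast
    show ?thesis
    proof (cases "w \<in> set q")
      case True
      then obtain q1 q2 where e: "q = q1 @ w # q2" by (meson split_list)
      have "path_in R A (q1 @ [w])" using q(1) e by (auto simp: path_in_def successively_append_iff)
      moreover have "hd (q1 @ [w]) = y" using q(2) e by (cases q1) auto
      ultimately show ?thesis unfolding K_def by force
    next
      case False
      have "path_in R A (q @ [w])"
        using q r w False by (intro path_in_append) (auto simp: path_in_def)
      moreover have "hd (q @ [w]) = y" using q by (auto simp: path_in_def)
      ultimately show ?thesis unfolding K_def by force
    qed
  qed
  then obtain u z where "u \<in> K" "z \<in> Z" "R u z" using cut[OF yK KA] by metis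
  then show ?thesis unfolding K_def by blast
qed

text \<open>
  The last two hypotheses say that \<open>B\<close> with \<open>s\<close> and with \<open>Z\<close> contracted to a point \<open>z\<close> is
  2-connected once \<open>s\<close> and \<open>z\<close> are joined. If some proper part \<open>D\<close> of \<open>B\<close> is separated by \<open>s\<close>
  and one more point, induction applies to \<open>D\<close> with that point as the new target; otherwise one
  can step from \<open>s\<close> to any neighbour in \<open>B\<close>, at the cost of one in the degrees.
\<close>

lemma ear:
  assumes "finite B" "finite Z" "s \<notin> B" "s \<notin> Z" "B \<inter> Z = {}" "B \<noteq> {}" "symp R" "irreflp R"
    and "\<And>b. b \<in> B \<Longrightarrow> d \<le> card {w \<in> insert s (B \<union> Z). R b w}"
    and "\<And>D. D \<subseteq> B \<Longrightarrow> D \<noteq> {} \<Longrightarrow> \<not> boundary R (insert s (B \<union> Z)) D \<subseteq> Z"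
    and "\<And>D y. D \<subseteq> B \<Longrightarrow> D \<noteq> {} \<Longrightarrow> \<not> boundary R (insert s (B \<union> Z)) D \<subseteq> {y}"
  shows "\<exists>p. path_in R B p \<and> R s (hd p) \<and> (\<exists>z\<in>Z. R (last p) z)
             \<and> d \<le> length p + card {z \<in> Z. R (last p) z}"
  using assms
proof (induction "card B" arbitrary: B Z s d rule: less_induct)
  case less
  let ?X = "insert s (B \<union> Z)"
  note fin = less.prems(1,2) and dis = less.prems(3-5) and ne = less.prems(6)
    and sym = less.prems(7,8) and deg = less.prems(9) and bZ = less.prems(10) and bp = less.prems(11)
  have symD: "R a b \<Longrightarrow> R b a" for a b using sym(1) by (meson sympD)
  \<comment> \<open>The second separating point is a vertex \<open>y\<close> of \<open>B - D\<close>
    in case \<open>pt\<close> and the contracted target in case \<open>Z\<close>.\<close>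
  consider (pt) D y where "D \<subset> B" "D \<noteq> {}" "y \<in> B - D" "boundary R ?X D \<subseteq> {s, y}"
    | (Z) D where "D \<subset> B" "D \<noteq> {}" "boundary R ?X D \<subseteq> insert s Z"
    | (none) "\<And>D y. D \<subset> B \<Longrightarrow> D \<noteq> {} \<Longrightarrow> y \<in> B - D \<Longrightarrow> \<not> boundary R ?X D \<subseteq> {s, y}"
      "\<And>D. D \<subset> B \<Longrightarrow> D \<noteq> {} \<Longrightarrow> \<not> boundary R ?X D \<subseteq> insert s Z"
    by blast
  then show ?case
  proof cases
    case pt
    have sub: "{w \<in> ?X. R b w} \<subseteq> {w \<in> insert s (D \<union> {y}). R b w}" if "b \<in> D" for b
      using pt that by (auto simp: boundary_def)
    have bd: "boundary R (insert s (D \<union> {y})) D' = boundary R ?X D'" if "D' \<subseteq> D" for D'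
      using pt that by (fastforce simp: boundary_def)
    have "\<exists>p. path_in R D p \<and> R s (hd p) \<and> (\<exists>z\<in>{y}. R (last p) z)
             \<and> d \<le> length p + card {z \<in> {y}. R (last p) z}"
    proof (rule less.hyps)
      show "card D < card B" using pt fin by (simp add: psubset_card_mono)
      show "finite D" using pt fin finite_subset by auto
      show "d \<le> card {w \<in> insert s (D \<union> {y}). R b w}" if "b \<in> D" for b
      proof -
        have "card {w \<in> ?X. R b w} \<le> card {w \<in> insert s (D \<union> {y}). R b w}"
          using sub[OF that] \<open>finite D\<close> by (intro card_mono) auto
        then show ?thesis using deg[of b] that pt by force
      qed
      show "\<not> boundary R (insert s (D \<union> {y})) D' \<subseteq> {y}" if "D' \<subseteq> D" "D' \<noteq> {}" for D'
        using bd[OF that(1)] bp[of D'] that pt by auto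
      show "\<not> boundary R (insert s (D \<union> {y})) D' \<subseteq> {x}" if "D' \<subseteq> D" "D' \<noteq> {}" for D' x
        using bd[OF that(1)] bp[of D'] that pt by auto
    qed (use pt dis sym in auto)
    then obtain p where p: "path_in R D p" "R s (hd p)" "R (last p) y"
      and len: "d \<le> length p + card {z \<in> {y}. R (last p) z}" by auto
    \<comment> \<open>Against the single target \<open>y\<close> the neighbour count is at most one;
      \<open>y\<close>, as the first vertex of the continuation \<open>q\<close>, makes up for it in
      the path length.\<close>
    have "card {z \<in> {y}. R (last p) z} \<le> card {y}" by (rule card_mono) auto
    then have len': "d \<le> length p + 1" using len by simp
    have "\<exists>q. path_in R (B - D) q \<and> hd q = y \<and> (\<exists>z\<in>Z. R (last q) z)"
    proof (rule path_to_exit)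
      show "y \<in> B - D" using pt by simp
      fix K assume K: "y \<in> K" "K \<subseteq> B - D" "\<And>u w. u \<in> K \<Longrightarrow> w \<in> B - D \<Longrightarrow> R u w \<Longrightarrow> w \<in> K"
      show "\<exists>u\<in>K. \<exists>z\<in>Z. R u z"
      proof (rule ccontr)
        assume n: "\<not> ?thesis"
        \<comment> \<open>Edges leave \<open>D\<close> only towards \<open>s\<close> and
          \<open>y\<close>, and \<open>K\<close> contains \<open>y\<close>, is closed in
          \<open>B - D\<close> and has no edge to \<open>Z\<close>; only \<open>s\<close>
          remains.\<close>
        have "boundary R ?X (D \<union> K) \<subseteq> {s}"
        proof
          fix w assume "w \<in> boundary R ?X (D \<union> K)"
          then obtain u where w: "w \<in> ?X" "w \<notin> D" "w \<notin> K" "u \<in> D \<union> K" "R u w"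
            by (auto simp: boundary_def)
          show "w \<in> {s}"
          proof (cases "u \<in> D")
            case True
            then have "w \<in> boundary R ?X D" using w by (auto simp: boundary_def)
            then show ?thesis using pt K w by auto
          next
            case False
            then show ?thesis using w K n by blast
          qed
        qed
        then show False using bp[of "D \<union> K" s] pt K by auto
      qed
    qed
    then obtain q where q: "path_in R (B - D) q" "hd q = y" "\<exists>z\<in>Z. R (last q) z" by blast
    have pq: "path_in R B (p @ q)"
      using p q pt by (intro path_in_append) (auto simp: path_in_def)
    have "q \<noteq> []" "p \<noteq> []" using p q by (auto simp: path_in_def)
    then have "length q \<ge> 1" by (cases q) auto
    then show ?thesis using pq p q len' \<open>q \<noteq> []\<close> \<open>p \<noteq> []\<close> by (intro exI[of _ "p @ q"]) auto
  next
    case Z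
    have bd: "boundary R (insert s (D \<union> Z)) D' = boundary R ?X D'" if "D' \<subseteq> D" for D'
      using Z that by (fastforce simp: boundary_def)
    have "\<exists>p. path_in R D p \<and> R s (hd p) \<and> (\<exists>z\<in>Z. R (last p) z)
             \<and> d \<le> length p + card {z \<in> Z. R (last p) z}"
    proof (rule less.hyps)
      show "card D < card B" using Z fin by (simp add: psubset_card_mono)
      show "finite D" using Z fin finite_subset by auto
      show "d \<le> card {w \<in> insert s (D \<union> Z). R b w}" if "b \<in> D" for b
      proof -
        have "{w \<in> ?X. R b w} \<subseteq> {w \<in> insert s (D \<union> Z). R b w}"
          using Z that by (auto simp: boundary_def)
        then have "card {w \<in> ?X. R b w} \<le> card {w \<in> insert s (D \<union> Z). R b w}"
          using \<open>finite D\<close> fin by (intro card_mono) auto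
        then show ?thesis using deg[of b] that Z by force
      qed
      show "\<not> boundary R (insert s (D \<union> Z)) D' \<subseteq> Z" if "D' \<subseteq> D" "D' \<noteq> {}" for D'
        using bd[OF that(1)] bZ[of D'] that Z by auto
      show "\<not> boundary R (insert s (D \<union> Z)) D' \<subseteq> {x}" if "D' \<subseteq> D" "D' \<noteq> {}" for D' x
        using bd[OF that(1)] bp[of D'] that Z by auto
    qed (use Z dis sym fin in auto)
    then show ?thesis using path_in_mono[of R D _ B] Z(1) by blast
  next
    case none
    \<comment> \<open>Outside \<open>B\<close> there are only \<open>s\<close> and \<open>Z\<close>,
      so a boundary not contained in \<open>Z\<close> contains \<open>s\<close>.\<close>
    have "s \<in> boundary R ?X B" using bZ[of B] ne by (auto simp: boundary_def)
    then obtain t where t: "t \<in> B" "R s t" using symD by (auto simp: boundary_def)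
    show ?thesis
    proof (cases "B = {t}")
      case True
      have "\<not> boundary R ?X B \<subseteq> {s}" using bp[of B s] ne by auto
      then have ex: "\<exists>z\<in>Z. R t z" using True by (auto simp: boundary_def)
      have "\<not> R t t" using sym(2) by (simp add: irreflpD)
      then have "{w \<in> ?X. R t w} \<subseteq> insert s {z \<in> Z. R t z}" using True by auto
      then have "card {w \<in> ?X. R t w} \<le> card (insert s {z \<in> Z. R t z})"
        using fin by (intro card_mono) auto
      also have "\<dots> \<le> Suc (card {z \<in> Z. R t z})" by (rule card_insert_le_m1) auto
      finally have "d \<le> Suc (card {z \<in> Z. R t z})" using deg[of t] t by simp
      then show ?thesis using ex t by (intro exI[of _ "[t]"]) (auto simp: path_in_def)
    next
      case False
      let ?B = "B - {t}"
      \<comment> \<open>Now \<open>t\<close> replaces \<open>s\<close> as the start: losing the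
        neighbour \<open>s\<close> costs at most one in each degree, and \<open>t\<close> adds one
        vertex to the path.\<close>
      have "\<exists>p. path_in R ?B p \<and> R t (hd p) \<and> (\<exists>z\<in>Z. R (last p) z)
             \<and> d - 1 \<le> length p + card {z \<in> Z. R (last p) z}"
      proof (rule less.hyps)
        show "card ?B < card B" using t fin by (meson card_Diff1_less)
        show "?B \<noteq> {}" using False t by blast
        show "d - 1 \<le> card {w \<in> insert t (?B \<union> Z). R b w}" if "b \<in> ?B" for b
        proof -
          have "{w \<in> ?X. R b w} \<subseteq> insert s {w \<in> insert t (?B \<union> Z). R b w}" by auto
          then have "card {w \<in> ?X. R b w} \<le> card (insert s {w \<in> insert t (?B \<union> Z). R b w})"
            using fin by (intro card_mono) auto
          also have "\<dots> \<le> Suc (card {w \<in> insert t (?B \<union> Z). R b w})" by (rule card_insert_le_m1) auto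
          finally show ?thesis using deg[of b] that by force
        qed
        \<comment> \<open>Dropping \<open>s\<close> from the ambient set removes at most
          \<open>s\<close> from a boundary, so a violating \<open>D\<close> would be one that case
          \<open>none\<close> excludes.\<close>
        have bd: "boundary R ?X D \<subseteq> insert s (boundary R (insert t (?B \<union> Z)) D)" for D
          by (auto simp: boundary_def)
        show *: "\<not> boundary R (insert t (?B \<union> Z)) D \<subseteq> Z" if "D \<subseteq> ?B" "D \<noteq> {}" for D
          using none(2)[of D] bd[of D] that t by blast
        show "\<not> boundary R (insert t (?B \<union> Z)) D \<subseteq> {y}" if D: "D \<subseteq> ?B" "D \<noteq> {}" for D y
        proof
          assume a: "boundary R (insert t (?B \<union> Z)) D \<subseteq> {y}"
          have "y \<in> boundary R (insert t (?B \<union> Z)) D" "y \<notin> Z" using *[OF D] a by auto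
          then have "y \<in> B - D" using t by (auto simp: boundary_def)
          then show False using none(1)[of D y] D t a bd[of D] by blast
        qed
      qed (use fin dis sym t in auto)
      then obtain p where p: "path_in R ?B p" "R t (hd p)" "\<exists>z\<in>Z. R (last p) z"
        "d - 1 \<le> length p + card {z \<in> Z. R (last p) z}" by blast
      have "path_in R B ([t] @ p)"
        using p t by (intro path_in_append) (auto simp: path_in_def)
      moreover have "p \<noteq> []" using p by (auto simp: path_in_def)
      ultimately show ?thesis using p t by (intro exI[of _ "[t] @ p"]) auto
    qed
  qed
qed

section \<open>Rerouting a longest cycle along an ear\<close>

lemma successively_take_drop:
  assumes "successively R c"
  shows "successively R (take i c)" "successively R (drop i c)"
  using assms successively_append_iff[of R "take i c" "drop i c"] by simp_all

text \<open>Let \<open>I\<close> be the positions on the cycle, other than the root, of the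
  neighbours of \<open>last p\<close>. By maximality \<open>I\<close> keeps a distance of more than
  \<open>length p\<close> from the root in both directions and contains no two consecutive
  positions. Hence \<open>I\<close> and its shift by one are disjoint subsets of
  \<open>{q + 1..l - q}\<close>, which gives the factor 2.\<close>

lemma longest_cycle_ear_bound:
  assumes sym: "symp R" and c: "cyc R c"
    and max: "\<And>c'. cyc R c' \<Longrightarrow> hd c' = hd c \<Longrightarrow> length c' \<le> length c"
    and p: "path_in R (- set c) p" "R (hd c) (hd p)"
    and ex: "\<exists>z \<in> set c - {hd c}. R (last p) z"
  shows "2 * (length p + card {z \<in> set c - {hd c}. R (last p) z}) \<le> length c"
proof -
  define l q where "l = length c" and "q = length p"
  define I where "I = {i. 1 \<le> i \<and> i < l \<and> R (last p) (c ! i)}"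
  have symD: "R a b \<Longrightarrow> R b a" for a b using sym by (meson sympD)
  have cd: "distinct c" "3 \<le> l" "successively R c" "R (last c) (hd c)" "c \<noteq> []"
    using c by (auto simp: cyc_def l_def)
  have pd: "distinct p" "p \<noteq> []" "successively R p" "set p \<inter> set c = {}" "last p \<notin> set c"
    using p last_in_set by (fastforce simp: path_in_def)+
  have q1: "1 \<le> q" using pd(2) by (cases p) (auto simp: q_def)
  have hc: "hd c = c ! 0" using cd by (simp add: hd_conv_nth)
  have Y: "{z \<in> set c - {hd c}. R (last p) z} = (!) c ` I"
    using cd by (fastforce simp: I_def l_def hc in_set_conv_nth nth_eq_iff_index_eq Suc_le_eq)
  have inj: "inj_on ((!) c) I" using cd by (auto simp: inj_on_def I_def l_def nth_eq_iff_index_eq)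
  have cY: "card {z \<in> set c - {hd c}. R (last p) z} = card I" using Y card_image[OF inj] by simp
  have Ine: "I \<noteq> {}" using ex Y by blast
  \<comment> \<open>Replace one of the two arcs between \<open>hd c\<close> and \<open>c ! i\<close> by \<open>p\<close>.\<close>
  have lo: "q + 1 \<le> i" if i: "i \<in> I" for i
  proof -
    have il: "1 \<le> i" "i < length c" "R (last p) (c ! i)" using i by (auto simp: I_def l_def)
    have "hd c \<notin> set (drop i c)" using cd il by (cases c; cases i) (auto dest: in_set_dropD)
    then have "cyc R (hd c # p @ drop i c)"
      using cd pd p il q1 successively_take_drop(2)[OF cd(3)]
      by (auto simp: cyc_def successively_append_iff successively_Cons hd_drop_conv_nth
          q_def dest: in_set_dropD)
    from max[OF this] show ?thesis using il by (simp add: q_def)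
  qed
  have hi: "i + q + 1 \<le> l" if i: "i \<in> I" for i
  proof -
    have il: "1 \<le> i" "i < length c" "R (last p) (c ! i)" using i by (auto simp: I_def l_def)
    have lt: "last (take (Suc i) c) = c ! i" using il by (simp add: take_Suc_conv_app_nth)
    have rp: "successively R (rev p)"
      unfolding successively_rev by (rule successively_mono[OF pd(3)]) (rule symD)
    have "set (take (Suc i) c) \<inter> set p = {}" using pd(4) set_take_subset by fastforce
    moreover have "successively R (take (Suc i) c @ rev p)"
      unfolding successively_append_iff
      using successively_take_drop(1)[OF cd(3)] rp lt il symD pd(2) by (simp add: hd_rev)
    moreover have "R (last (rev p)) (hd c)" using p(2) symD pd(2) by (simp add: last_rev)
    moreover have "3 \<le> length (take (Suc i) c @ rev p)" using il q1 by (simp add: q_def)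
    ultimately have "cyc R (take (Suc i) c @ rev p)"
      unfolding cyc_def using cd(1,5) pd(1,2) by simp
    from max[OF this] show ?thesis using il cd(5) by (simp add: q_def l_def)
  qed
  \<comment> \<open>Otherwise \<open>last p\<close> could be inserted between \<open>c ! i\<close> and \<open>c ! Suc i\<close>.\<close>
  have gap: "Suc i \<notin> I" if i: "i \<in> I" for i
  proof
    assume "Suc i \<in> I"
    then have il: "1 \<le> i" "Suc i < length c" "R (last p) (c ! i)" "R (last p) (c ! Suc i)"
      using i by (auto simp: I_def l_def)
    have lt: "last (take (Suc i) c) = c ! i" using il by (simp add: take_Suc_conv_app_nth)
    have "set (take (Suc i) c) \<inter> set (drop (Suc i) c) = {}"
      using cd(1) by (intro set_take_disj_set_drop_if_distinct) auto
    moreover have "last p \<notin> set (take (Suc i) c)" "last p \<notin> set (drop (Suc i) c)"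
      using pd(5) by (auto dest: in_set_takeD in_set_dropD)
    moreover have "successively R (take (Suc i) c @ [last p] @ drop (Suc i) c)"
      unfolding successively_append_iff
      using successively_take_drop[OF cd(3)] lt il symD by (simp add: hd_drop_conv_nth)
    moreover have "3 \<le> length (take (Suc i) c @ [last p] @ drop (Suc i) c)"
      using il by simp
    ultimately have "cyc R (take (Suc i) c @ [last p] @ drop (Suc i) c)"
      unfolding cyc_def using cd(1,4,5) il by simp
    from max[OF this] show False using il cd(5) by simp
  qed
  have fI: "finite I" by (simp add: I_def)
  have "card (I \<union> Suc ` I) = card I + card (Suc ` I)" using gap fI by (intro card_Un_disjoint) auto
  also have "\<dots> = 2 * card I" by (simp add: card_image)
  finally have "2 * card I = card (I \<union> Suc ` I)" ..
  also have "\<dots> \<le> card {q + 1..l - q}"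
    using lo hi by (intro card_mono) (fastforce simp: Suc_le_eq)+
  finally have "2 * card I \<le> l - 2 * q" by simp
  \<comment> \<open>The subtraction above is truncated; an element of \<open>I\<close> shows that
    \<open>2 * q\<close> is at most \<open>l\<close>.\<close>
  moreover obtain i where "i \<in> I" using Ine by blast
  ultimately show ?thesis using lo[of i] hi[of i] cY by (simp add: l_def q_def)
qed

section \<open>A long cycle through a vertex of large degree\<close>

text \<open>Here \<open>no_cut\<close> is 2-connectedness in boundary form: the boundary of
  \<open>D\<close> lies in a single point only if that point and \<open>D\<close> exhaust
  \<open>U\<close>. This matches the hypotheses of \<open>ear\<close>, which is used twice: for a
  first cycle through \<open>v\<close>, and for an ear on a longest one.\<close>

lemma long_cycle_through:
  assumes U: "finite U" "v \<in> U" and R: "symp R" "irreflp R" "\<And>x y. R x y \<Longrightarrow> y \<in> U"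
    and no_cut: "\<And>D z. D \<subseteq> U \<Longrightarrow> D \<noteq> {} \<Longrightarrow> \<not> U \<subseteq> insert z D \<Longrightarrow> \<exists>u\<in>D. \<exists>w\<in>U - D - {z}. R u w"
    and deg: "\<And>u. u \<in> U \<Longrightarrow> k \<le> 2 * card {w. R u w}"
    and v: "k \<le> card {w. R v w} + 1" and k: "3 \<le> k"
  shows "\<exists>c. cyc R c \<and> hd c = v \<and> k \<le> length c"
proof -
  \<comment> \<open>Half of \<open>k\<close> rounded up: integral degrees still reach
    \<open>d\<close>, and \<open>2 * d\<close> is at least \<open>k\<close>.\<close>
  define d where "d = (k + 1) div 2"
  have symD: "R a b \<Longrightarrow> R b a" for a b using R(1) by (meson sympD)
  have irr: "\<not> R a a" for a using R(2) by (simp add: irreflpD)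
  have fin: "finite {w. R u w}" for u using R(3) U finite_subset[of "{w. R u w}" U] by blast
  have degd: "d \<le> card {w. R u w}" if "u \<in> U" for u using deg[OF that] by (simp add: d_def)
  have sub: "cyc R c \<Longrightarrow> set c \<subseteq> U" for c
  proof
    fix x assume c: "cyc R c" and x: "x \<in> set c"
    then obtain i where i: "i < length c" "x = c ! i" by (auto simp: in_set_conv_nth)
    show "x \<in> U"
    proof (cases i)
      case 0
      then show ?thesis using c i R(3) by (auto simp: cyc_def hd_conv_nth)
    next
      case (Suc j)
      have "successively R (drop j c)" using c successively_take_drop by (auto simp: cyc_def)
      moreover have "drop j c = c ! j # c ! Suc j # drop (Suc (Suc j)) c"
        using i Suc by (simp add: Cons_nth_drop_Suc)
      ultimately have "R (c ! j) (c ! Suc j)" by simp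
      then show ?thesis using R(3) i Suc by blast
    qed
  qed
  have lenU: "cyc R c \<Longrightarrow> length c \<le> card U" for c
    using sub[of c] U card_mono[of U "set c"] by (simp add: cyc_def distinct_card)
  have ex: "\<exists>c. cyc R c \<and> hd c = v"
  proof -
    have "{w. R v w} \<noteq> {}" using v k by (intro notI) simp
    then obtain a where a: "R v a" by blast
    have av: "a \<noteq> v" "a \<in> U" using a irr R(3) by auto
    let ?B = "U - {v, a}"
    have X: "insert v (?B \<union> {a}) = U" using av U by auto
    have "?B \<noteq> {}"
    proof
      assume "?B = {}"
      then have "{w. R v w} \<subseteq> {a}" using R(3) irr by blast
      then have "card {w. R v w} \<le> card {a}" by (intro card_mono) auto
      then show False using v k by simp
    qed
    have b2: "\<not> boundary R (insert v (?B \<union> {a})) D \<subseteq> {y}" if D: "D \<subseteq> ?B" "D \<noteq> {}" for D y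
    proof -
      have "\<not> U \<subseteq> insert y D" using D U av by blast
      then obtain u w where "u \<in> D" "w \<in> U - D - {y}" "R u w" using no_cut[of D y] D by blast
      then show ?thesis unfolding X boundary_def by blast
    qed
    \<comment> \<open>Any path from \<open>v\<close> to its neighbour \<open>a\<close> through other
      vertices closes to a cycle, so the degree bound is taken to be 0.\<close>
    have "\<exists>p. path_in R ?B p \<and> R v (hd p) \<and> (\<exists>z\<in>{a}. R (last p) z)
             \<and> 0 \<le> length p + card {z \<in> {a}. R (last p) z}"
      by (rule ear) (use U R \<open>?B \<noteq> {}\<close> av b2 in auto)
    then obtain p where p: "path_in R ?B p" "R v (hd p)" "R (last p) a" by auto
    have "p \<noteq> []" using p by (auto simp: path_in_def)
    then have "1 \<le> length p" by (cases p) auto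
    then have "cyc R (v # p @ [a])" using p a av symD \<open>p \<noteq> []\<close>
      by (auto simp: cyc_def path_in_def successively_append_iff successively_Cons)
    then show ?thesis by force
  qed
  obtain c where c: "cyc R c" "hd c = v"
    and max: "\<And>c'. cyc R c' \<Longrightarrow> hd c' = v \<Longrightarrow> length c' \<le> length c"
    using ex_has_greatest_nat[of "\<lambda>c. cyc R c \<and> hd c = v" _ length "Suc (card U)"] ex lenU by (metis le_imp_less_Suc)
  show ?thesis
  proof (rule ccontr)
    assume "\<not> ?thesis"
    then have short: "length c < k" using c by (metis not_le)
    let ?Z = "set c - {v}"
    have c3: "3 \<le> length c" "distinct c" "c \<noteq> []" using c by (auto simp: cyc_def)
    have vc: "v \<in> set c" using c c3 hd_in_set by blast
    have cZ: "card ?Z = length c - 1" using c3 vc by (simp add: distinct_card)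
    \<comment> \<open>The cycle has at most \<open>k - 2\<close> vertices besides \<open>v\<close>,
      while \<open>v\<close> has at least \<open>k - 1\<close> neighbours.\<close>
    obtain w where w: "R v w" "w \<notin> set c"
    proof -
      have "\<not> {w. R v w} \<subseteq> ?Z"
      proof
        assume "{w. R v w} \<subseteq> ?Z"
        then have "card {w. R v w} \<le> card ?Z" by (intro card_mono) auto
        then show False using cZ v short c3 by simp
      qed
      then show ?thesis using that irr by blast
    qed
    \<comment> \<open>A minimal closed set is the component of \<open>w\<close> in the complement of the cycle.\<close>
    define closed where "closed = (\<lambda>B. w \<in> B \<and> B \<subseteq> U - set c \<and>
      (\<forall>x\<in>B. \<forall>y. R x y \<longrightarrow> y \<notin> set c \<longrightarrow> y \<in> B))"
    have "closed (U - set c)" using w R(3) by (auto simp: closed_def)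
    then obtain B where B: "closed B" and Bmin: "\<And>B'. closed B' \<Longrightarrow> card B \<le> card B'"
      using ex_has_least_nat[of closed _ card] by metis
    have BU: "B \<subseteq> U - set c" "w \<in> B" using B by (auto simp: closed_def)
    have finB: "finite B" using BU U finite_subset by blast
    have nb: "R x y \<Longrightarrow> y \<in> insert v (B \<union> ?Z)" if "x \<in> B" for x y
      using B that by (auto simp: closed_def)
    have bd: "boundary R (insert v (B \<union> ?Z)) D = {w. w \<notin> D \<and> (\<exists>u\<in>D. R u w)}" if "D \<subseteq> B" for D
      using nb that by (auto simp: boundary_def)
    have bp: "\<not> boundary R (insert v (B \<union> ?Z)) D \<subseteq> {y}" if D: "D \<subseteq> B" "D \<noteq> {}" for D y
    proof -
      have "\<not> set c \<subseteq> {y}"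
      proof
        assume "set c \<subseteq> {y}"
        then have "card (set c) \<le> card {y}" by (intro card_mono) auto
        then show False using c3 by (simp add: distinct_card)
      qed
      then have "\<not> U \<subseteq> insert y D" using D BU sub[OF c(1)] by blast
      then obtain u w where "u \<in> D" "w \<in> U - D - {y}" "R u w" using no_cut[of D y] D BU by blast
      then show ?thesis unfolding bd[OF D(1)] by blast
    qed
    have bZ: "\<not> boundary R (insert v (B \<union> ?Z)) D \<subseteq> ?Z" if D: "D \<subseteq> B" "D \<noteq> {}" for D
    proof
      assume a: "boundary R (insert v (B \<union> ?Z)) D \<subseteq> ?Z"
      show False
      proof (cases "w \<in> D")
        case True
        have "v \<notin> D" using D BU vc by blast
        then have "v \<in> boundary R (insert v (B \<union> ?Z)) D"
          unfolding bd[OF D(1)] using True w symD by blast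
        then show False using a by blast
      next
        case False
        \<comment> \<open>A part without \<open>w\<close> whose boundary lies on the cycle could be
          removed from \<open>B\<close>, leaving a smaller closed set.\<close>
        have "closed (B - D)" unfolding closed_def
        proof (intro conjI ballI allI impI)
          fix x y assume xy: "x \<in> B - D" "R x y" "y \<notin> set c"
          then have "y \<in> B" using nb[of x y] vc by blast
          moreover have "y \<notin> D"
          proof
            assume "y \<in> D"
            then have "x \<in> boundary R (insert v (B \<union> ?Z)) D"
              unfolding bd[OF D(1)] using xy symD by blast
            then show False using a xy BU by blast
          qed
          ultimately show "y \<in> B - D" by simp
        qed (use False BU in auto)
        then have "card B \<le> card (B - D)" by (rule Bmin)
        moreover have "card (B - D) < card B" using D finB by (intro psubset_card_mono) auto
        ultimately show False by simp
      qed
    qed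
    have dB: "d \<le> card {y \<in> insert v (B \<union> ?Z). R b y}" if "b \<in> B" for b
    proof -
      have "{y \<in> insert v (B \<union> ?Z). R b y} = {y. R b y}" using nb that by blast
      then show ?thesis using degd[of b] that BU by auto
    qed
    have "\<exists>p. path_in R B p \<and> R v (hd p) \<and> (\<exists>z\<in>?Z. R (last p) z)
             \<and> d \<le> length p + card {z \<in> ?Z. R (last p) z}"
      by (rule ear) (use finB BU R vc dB bZ bp in auto)
    then obtain p where p: "path_in R B p" "R v (hd p)" "\<exists>z\<in>?Z. R (last p) z"
      "d \<le> length p + card {z \<in> ?Z. R (last p) z}" by blast
    have "path_in R (- set c) p" using path_in_mono[OF p(1)] BU by blast
    from longest_cycle_ear_bound[OF R(1) c(1) _ this] p max c(2)
    have "2 * (length p + card {z \<in> ?Z. R (last p) z}) \<le> length c" by simp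
    then show False using p(4) short by (simp add: d_def)
  qed
qed

section \<open>From a long cycle to a keyring\<close>

text \<open>Cut the cycle at the first neighbour \<open>c ! j\<close> of \<open>v\<close> with
  \<open>j\<close> at least \<open>s - 1\<close>. The neighbours of \<open>v\<close> that stay on
  the shorter cycle have positions in \<open>{1..s - 2}\<close> or equal to \<open>j\<close>, so
  there are at most \<open>s - 1\<close> of them.\<close>

lemma short_chord_cycle:
  assumes c: "cyc R c" "hd c = v" "s \<le> length c" and s: "3 \<le> s" and R: "symp R" "irreflp R"
    and fin: "finite {w. R v w}"
  obtains c' where "cyc R c'" "hd c' = v" "s \<le> length c'"
    "card {w. R v w} + 1 \<le> s + card ({w. R v w} - set c')"
proof -
  have c': "distinct c" "3 \<le> length c" "successively R c" "R (last c) v" "c \<noteq> []"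
    using c by (auto simp: cyc_def)
  have symD: "R a b \<Longrightarrow> R b a" for a b using R(1) by (meson sympD)
  have c0: "c ! 0 = v" using c c' by (simp add: hd_conv_nth)
  define P where "P = (\<lambda>j. s \<le> j + 1 \<and> j < length c \<and> R v (c ! j))"
  \<comment> \<open>The closing edge of \<open>c\<close> guarantees a candidate.\<close>
  have "P (length c - 1)" using c c' symD by (auto simp: P_def last_conv_nth)
  then have "P (Least P)" and least: "\<And>i. P i \<Longrightarrow> Least P \<le> i"
    by (auto intro: LeastI Least_le)
  define j where "j = Least P"
  have j: "s \<le> j + 1" "j < length c" "R v (c ! j)" using \<open>P (Least P)\<close> by (auto simp: j_def P_def)
  let ?c = "take (Suc j) c"
  have lt: "last ?c = c ! j" using j by (simp add: take_Suc_conv_app_nth)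
  have "cyc R ?c" unfolding cyc_def
    using c' j s lt c(2) symD successively_take_drop(1)[OF c'(3)] by simp
  moreover have "hd ?c = v" using c by simp
  moreover have "s \<le> length ?c" using j by simp
  moreover have "card {w. R v w} + 1 \<le> s + card ({w. R v w} - set ?c)"
  proof -
    have "{w. R v w} \<inter> set ?c \<subseteq> (!) c ` ({1..s - 2} \<union> {j})"
    proof
      fix x assume x: "x \<in> {w. R v w} \<inter> set ?c"
      then obtain i where i: "i < Suc j" "i < length c" "x = c ! i" by (auto simp: in_set_conv_nth)
      have "i \<noteq> 0" using i x c0 irreflpD[OF R(2)] by (intro notI) auto
      moreover have "s \<le> i + 1 \<Longrightarrow> i = j"
        using least[of i] x i by (simp add: P_def j_def)
      ultimately have "i \<in> {1..s - 2} \<union> {j}" by auto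
      then show "x \<in> (!) c ` ({1..s - 2} \<union> {j})" using i by blast
    qed
    then have "card ({w. R v w} \<inter> set ?c) \<le> card ((!) c ` ({1..s - 2} \<union> {j}))"
      by (intro card_mono) auto
    also have "\<dots> \<le> card ({1..s - 2} \<union> {j})" by (intro card_image_le) auto
    also have "\<dots> \<le> card {1..s - 2} + card {j}" by (rule card_Un_le)
    finally have "card ({w. R v w} \<inter> set ?c) + 1 \<le> s" using s by simp
    moreover have "card {w. R v w} = card ({w. R v w} \<inter> set ?c) + card ({w. R v w} - set ?c)"
      using fin by (metis card_Int_Diff)
    ultimately show ?thesis by simp
  qed
  ultimately show ?thesis by (rule that)
qed

lemma cyc_edge:
  assumes "cyc R c" "i < length c"
  shows "R (c ! i) (c ! (Suc i mod length c))"
proof (cases "Suc i = length c")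
  case True
  then have "last c = c ! i" using assms by (metis diff_Suc_1 last_conv_nth list.size(3) not_less_zero)
  moreover have "hd c = c ! 0" using assms by (metis hd_conv_nth list.size(3) not_less_zero)
  ultimately show ?thesis using True assms by (simp add: cyc_def)
next
  case False
  then have i: "Suc i < length c" using assms by simp
  have "successively R (drop i c)" using assms successively_take_drop by (auto simp: cyc_def)
  moreover have "drop i c = c ! i # c ! Suc i # drop (Suc (Suc i)) c"
    using i by (simp add: Cons_nth_drop_Suc)
  ultimately show ?thesis using i by simp
qed

text \<open>Two positions giving the same edge would be cyclic successors of each other, which
  length at least 3 rules out.\<close>

lemma card_cycle_edges:
  assumes "distinct c" "3 \<le> length c"
  shows "card {{c ! i, c ! (Suc i mod length c)} | i. i < length c} = length c"
proof -
  let ?n = "length c"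
  have lt: "Suc i mod ?n < ?n" for i using assms by (intro mod_less_divisor) auto
  have "inj_on (\<lambda>i. {c ! i, c ! (Suc i mod ?n)}) {..<?n}"
  proof (rule inj_onI)
    fix i j assume ij: "i \<in> {..<?n}" "j \<in> {..<?n}"
      and eq: "{c ! i, c ! (Suc i mod ?n)} = {c ! j, c ! (Suc j mod ?n)}"
    show "i = j"
    proof (rule ccontr)
      assume "i \<noteq> j"
      then have "c ! i = c ! (Suc j mod ?n)" "c ! j = c ! (Suc i mod ?n)"
        using eq ij assms by (auto simp: doubleton_eq_iff nth_eq_iff_index_eq)
      then have "i = Suc j mod ?n" "j = Suc i mod ?n"
        using ij lt assms by (simp_all add: nth_eq_iff_index_eq)
      moreover have "Suc x = ?n \<and> Suc x mod ?n = 0 \<or> Suc x mod ?n = Suc x" if "x < ?n" for x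
        using that by (cases "Suc x = ?n") auto
      ultimately have "Suc j = ?n \<and> i = 0 \<or> i = Suc j" "Suc i = ?n \<and> j = 0 \<or> j = Suc i"
        using ij by (metis lessThan_iff)+
      then show False using assms(2) by arith
    qed
  qed
  then have "card ((\<lambda>i. {c ! i, c ! (Suc i mod ?n)}) ` {..<?n}) = ?n" by (simp add: card_image)
  moreover have "(\<lambda>i. {c ! i, c ! (Suc i mod ?n)}) ` {..<?n}
      = {{c ! i, c ! (Suc i mod ?n)} | i. i < ?n}" by auto
  ultimately show ?thesis by simp
qed

text \<open>The sizes add up because a pendant edge has an end in \<open>L\<close>, off the cycle,
  whereas cycle edges have both ends on it.\<close>

lemma keyring_of_cyc:
  assumes c: "cyc R c" "hd c = v" and L: "finite L" "L \<subseteq> {w. R v w}" "L \<inter> set c = {}"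
    and R: "irreflp R" "\<And>x y. R x y \<Longrightarrow> x \<in> V \<and> y \<in> V \<and> {x, y} \<in> E"
  shows "\<exists>V' E'. subgraph V' E' V E \<and> is_keyring (card L) V' E' \<and> card E' = length c + card L"
proof -
  define F where "F = {{c ! i, c ! (Suc i mod length c)} | i. i < length c}"
  define M where "M = {{v, u} | u. u \<in> L}"
  have c': "distinct c" "3 \<le> length c" "c \<noteq> []" using c by (auto simp: cyc_def)
  have v: "v \<in> set c" using c c' hd_in_set by blast
  have mod: "Suc i mod length c < length c" for i using c' by (intro mod_less_divisor) auto
  have cy: "is_cycle (set c) F" using c' unfolding is_cycle_def F_def by blast
  have FE: "\<exists>x\<in>set c. \<exists>y\<in>set c. e = {x, y} \<and> R x y" if "e \<in> F" for e
    using that cyc_edge[OF c(1)] mod unfolding F_def by fastforce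
  have ME: "\<exists>y\<in>L. e = {v, y} \<and> R v y" if "e \<in> M" for e using that L unfolding M_def by blast
  have irr: "R x y \<Longrightarrow> x \<noteq> y" for x y using R(1) by (auto simp: irreflpD)
  have VV: "set c \<union> L \<subseteq> V"
  proof
    fix x assume "x \<in> set c \<union> L"
    then consider "x \<in> L" | i where "i < length c" "x = c ! i" by (auto simp: in_set_conv_nth)
    then show "x \<in> V"
    proof cases
      case 1
      then show ?thesis using L(2) R(2) by blast
    next
      case 2
      then show ?thesis using cyc_edge[OF c(1)] R(2) by blast
    qed
  qed
  have "simple_graph (set c \<union> L) (F \<union> M)" unfolding simple_graph_def
  proof (intro conjI ballI)
    fix e assume "e \<in> F \<union> M"
    then obtain x y where "e = {x, y}" "R x y" "x \<in> set c \<union> L" "y \<in> set c \<union> L"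
      using FE ME v by blast
    then show "e \<subseteq> set c \<union> L" "card e = 2" using irr[of x y] by auto
  qed (use L in simp)
  moreover have "F \<union> M \<subseteq> E" using FE ME R(2) by blast
  ultimately have "subgraph (set c \<union> L) (F \<union> M) V E" using VV by (simp add: subgraph_def)
  moreover have "is_keyring (card L) (set c \<union> L) (F \<union> M)"
    unfolding is_keyring_def M_def using cy v L by blast
  moreover have "card (F \<union> M) = length c + card L"
  proof -
    have MI: "M = (\<lambda>u. {v, u}) ` L" by (auto simp: M_def)
    have "inj_on (\<lambda>u. {v, u}) L" by (auto simp: inj_on_def doubleton_eq_iff)
    then have "card M = card L" "finite M" using MI L by (simp_all add: card_image)
    moreover have "card F = length c" using card_cycle_edges[OF c'(1,2)] by (simp add: F_def)
    moreover have "finite F" by (simp add: F_def)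
    moreover have "F \<inter> M = {}" using FE ME L(3) by (fastforce simp: doubleton_eq_iff)
    ultimately show ?thesis by (simp add: card_Un_disjoint)
  qed
  ultimately show ?thesis by blast
qed

section \<open>Edge counting and minimal dense vertex sets\<close>

definition induced :: "'a set set \<Rightarrow> 'a set \<Rightarrow> 'a set set" where
  "induced E U = {e \<in> E. e \<subseteq> U}"

text \<open>The condition on \<open>u\<close> makes the set empty outside \<open>U\<close>, so it
  agrees for every \<open>u\<close> with the neighbourhood in the graph induced on
  \<open>U\<close>.\<close>

definition nbrs :: "'a set set \<Rightarrow> 'a set \<Rightarrow> 'a \<Rightarrow> 'a set" where
  "nbrs E U u = {w. u \<in> U \<and> w \<in> U \<and> {u, w} \<in> E}"

lemma card_nbrs:
  assumes "\<And>e. e \<in> E \<Longrightarrow> card e = 2" "u \<in> U"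
  shows "card (nbrs E U u) = card {e \<in> induced E U. u \<in> e}"
proof (rule bij_betw_same_card)
  show "bij_betw (\<lambda>w. {u, w}) (nbrs E U u) {e \<in> induced E U. u \<in> e}"
    unfolding bij_betw_def
  proof
    show "inj_on (\<lambda>w. {u, w}) (nbrs E U u)" by (auto simp: inj_on_def doubleton_eq_iff)
    show "(\<lambda>w. {u, w}) ` nbrs E U u = {e \<in> induced E U. u \<in> e}"
    proof
      show "{e \<in> induced E U. u \<in> e} \<subseteq> (\<lambda>w. {u, w}) ` nbrs E U u"
      proof
        fix e assume e: "e \<in> {e \<in> induced E U. u \<in> e}"
        then have "card e = 2" using assms by (simp add: induced_def)
        then obtain x y where "e = {x, y}" by (auto simp: card_2_iff)
        then obtain w where "e = {u, w}" using e by auto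
        then show "e \<in> (\<lambda>w. {u, w}) ` nbrs E U u" using e by (auto simp: induced_def nbrs_def)
      qed
    qed (auto simp: induced_def nbrs_def)
  qed
qed

lemma handshake:
  assumes "finite E" "\<And>e. e \<in> E \<Longrightarrow> card e = 2" "finite U"
  shows "(\<Sum>u\<in>U. card (nbrs E U u)) = 2 * card (induced E U)"
proof -
  have "(\<Sum>u\<in>U. card (nbrs E U u)) = (\<Sum>u\<in>U. card {e \<in> induced E U. u \<in> e})"
    using assms by (intro sum.cong) (auto simp: card_nbrs)
  also have "\<dots> = 2 * card (induced E U)"
  proof (rule sum_multicount)
    show "\<forall>e\<in>induced E U. card {u \<in> U. u \<in> e} = 2"
    proof
      fix e assume "e \<in> induced E U"
      then have "{u \<in> U. u \<in> e} = e" "card e = 2" using assms by (auto simp: induced_def)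
      then show "card {u \<in> U. u \<in> e} = 2" by simp
    qed
  qed (use assms in \<open>auto simp: induced_def\<close>)
  finally show ?thesis .
qed

text \<open>Density means twice the edge number exceeds \<open>m * (card U - 1)\<close>, written
  without subtraction. The shift by one suits cuts: two pieces sharing one vertex have values
  \<open>card - 1\<close> that add up exactly, so a dense set with a cut vertex has a dense proper
  piece.\<close>

lemma minimal_dense_subset:
  assumes "finite V" "finite E" "\<And>e. e \<in> E \<Longrightarrow> card e = 2" "V \<noteq> {}"
    and "m * card V < 2 * card (induced E V) + m"
  obtains U where "U \<noteq> {}" "U \<subseteq> V"
    "\<And>u. u \<in> U \<Longrightarrow> m < 2 * card (nbrs E U u)"
    "\<And>D z. D \<subseteq> U \<Longrightarrow> D \<noteq> {} \<Longrightarrow> \<not> U \<subseteq> insert z D \<Longrightarrow> \<exists>u\<in>D. \<exists>w\<in>U - D - {z}. {u, w} \<in> E"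
    "\<exists>v\<in>U. m \<le> card (nbrs E U v)"
proof -
  define P where "P = (\<lambda>U. U \<noteq> {} \<and> U \<subseteq> V \<and> m * card U < 2 * card (induced E U) + m)"
  have "P V" using assms by (simp add: P_def)
  then obtain U where U: "P U" and min: "\<And>U'. P U' \<Longrightarrow> card U \<le> card U'"
    using ex_has_least_nat[of P V card] by blast
  have U': "U \<noteq> {}" "U \<subseteq> V" "m * card U < 2 * card (induced E U) + m" using U by (auto simp: P_def)
  have fU: "finite U" using U' assms finite_subset by blast
  have fi: "finite (induced E X)" for X using assms by (simp add: induced_def)
  have sparse: "2 * card (induced E X) + m \<le> m * card X" if "X \<subset> U" "X \<noteq> {}" for X
  proof -
    have "\<not> P X" using min[of X] psubset_card_mono[OF fU that(1)] by auto
    then show ?thesis using that U' by (auto simp: P_def)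
  qed
  have hs: "(\<Sum>u\<in>U. card (nbrs E U u)) = 2 * card (induced E U)"
    by (rule handshake) (use assms fU in auto)
  have nb: "card (nbrs E U u) \<le> card U - 1" if "u \<in> U" for u
  proof -
    have "nbrs E U u \<subseteq> U - {u}" using assms(3) by (fastforce simp: nbrs_def)
    then have "card (nbrs E U u) \<le> card (U - {u})" using fU by (intro card_mono) auto
    then show ?thesis using that by simp
  qed
  have nbsum: "2 * card (induced E U) \<le> card U * b" if "\<And>u. u \<in> U \<Longrightarrow> card (nbrs E U u) \<le> b" for b
    using sum_bounded_above[of U "\<lambda>u. card (nbrs E U u)" b] that hs by simp
  \<comment> \<open>Comparing the trivial degree bound \<open>card U - 1\<close> with density yields
    \<open>m < card U\<close>.\<close>
  have "2 * card (induced E U) \<le> card U * (card U - 1)" using nb by (rule nbsum)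
  then have "m * (card U - 1) < card U * (card U - 1)"
    using U' fU by (cases "card U") auto
  then have big: "m < card U" by simp
  have heavy: "\<exists>v\<in>U. m \<le> card (nbrs E U v)"
  proof (rule ccontr)
    assume "\<not> ?thesis"
    then have "\<And>u. u \<in> U \<Longrightarrow> card (nbrs E U u) \<le> m - 1" and "0 < m" using U'(1) by fastforce+
    \<comment> \<open>If all degrees were at most \<open>m - 1\<close>, density would force
      \<open>card U < m\<close>, contrary to \<open>big\<close>.\<close>
    then have "2 * card (induced E U) \<le> card U * (m - 1)" by (intro nbsum)
    then have "m * card U < card U * (m - 1) + m" using U' by linarith
    moreover obtain m' where "m = Suc m'" using \<open>0 < m\<close> by (cases m) auto
    ultimately show False using big by (simp add: mult.commute)
  qed
  have deg: "m < 2 * card (nbrs E U u)" if u: "u \<in> U" for u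
  \<comment> \<open>Sparseness of \<open>U - {u}\<close> needs this set to be nonempty. Then the
    edges lost with \<open>u\<close> account for more than \<open>m / 2\<close>.\<close>
  proof (cases "U = {u}")
    case True
    then show ?thesis using big nb[OF u] U'(3) hs by simp
  next
    case False
    have "induced E U \<subseteq> induced E (U - {u}) \<union> {e \<in> induced E U. u \<in> e}" by (auto simp: induced_def)
    then have "card (induced E U) \<le> card (induced E (U - {u}) \<union> {e \<in> induced E U. u \<in> e})"
      using fi by (intro card_mono) auto
    also have "\<dots> \<le> card (induced E (U - {u})) + card {e \<in> induced E U. u \<in> e}" by (rule card_Un_le)
    also have "card {e \<in> induced E U. u \<in> e} = card (nbrs E U u)"
      using card_nbrs[of E u U] assms(3) u by simp
    finally have 1: "card (induced E U) \<le> card (induced E (U - {u})) + card (nbrs E U u)" .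
    have 2: "2 * card (induced E (U - {u})) + m \<le> m * card (U - {u})"
      by (rule sparse) (use u False in auto)
    have "card U = Suc (card (U - {u}))" using card_Suc_Diff1[OF fU u] by simp
    then have "m * card U = m * card (U - {u}) + m" by simp
    then show ?thesis using 1 2 U'(3) by linarith
  qed
  have cut: "\<exists>u\<in>D. \<exists>w\<in>U - D - {z}. {u, w} \<in> E"
    if D: "D \<subseteq> U" "D \<noteq> {}" "\<not> U \<subseteq> insert z D" for D z
  proof (rule ccontr)
    assume n: "\<not> ?thesis"
    \<comment> \<open>Both pieces are proper and nonempty, share at most \<open>z\<close>, and
      together contain every edge; adding their sparseness bounds contradicts the density of
      \<open>U\<close>.\<close>
    let ?A = "insert z D \<inter> U" and ?B = "U - D"
    have "induced E U \<subseteq> induced E ?A \<union> induced E ?B"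
    proof
      fix e assume e: "e \<in> induced E U"
      then have "card e = 2" using assms(3) by (simp add: induced_def)
      then obtain x y where "e = {x, y}" by (meson card_2_iff)
      then have xy: "e = {x, y}" "x \<in> U" "y \<in> U" "{x, y} \<in> E" using e by (auto simp: induced_def)
      then have "{y, x} \<in> E" by (simp add: insert_commute)
      then show "e \<in> induced E ?A \<union> induced E ?B" using xy n by (auto simp: induced_def)
    qed
    then have "card (induced E U) \<le> card (induced E ?A \<union> induced E ?B)"
      using fi by (intro card_mono) auto
    also have "\<dots> \<le> card (induced E ?A) + card (induced E ?B)" by (rule card_Un_le)
    finally have 1: "card (induced E U) \<le> card (induced E ?A) + card (induced E ?B)" .
    have 2: "2 * card (induced E ?A) + m \<le> m * card ?A" by (rule sparse) (use D in auto)
    have 3: "2 * card (induced E ?B) + m \<le> m * card ?B" by (rule sparse) (use D in auto)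
    have fD: "finite D" using D(1) fU by (rule finite_subset)
    then have "card ?A \<le> card (insert z D)" by (intro card_mono) auto
    also have "\<dots> \<le> Suc (card D)" by (rule card_insert_le_m1) auto
    finally have "card ?A + card ?B \<le> card U + 1"
      using card_mono[OF fU D(1)] card_Diff_subset[OF fD D(1)] by linarith
    then have "m * (card ?A + card ?B) \<le> m * (card U + 1)" by (rule mult_le_mono2)
    then have "m * card ?A + m * card ?B \<le> m * card U + m" by (simp add: algebra_simps)
    then show False using 1 2 3 U'(3) by linarith
  qed
  show ?thesis using that[OF U'(1,2) deg cut heavy] by blast
qed

theorem theorem4:
  fixes k r n :: nat
    and V :: "'a set" and E :: "'a set set"
  assumes "r + 3 \<le> k"
    and "simple_graph V E"
    and "card V = n"
    and "real (card E) > (real k - 1) * real n / 2"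
  shows "\<exists>V' E'. subgraph V' E' V E \<and> is_keyring r V' E' \<and> card E' \<ge> k"
proof -
  have V: "finite V" "\<And>e. e \<in> E \<Longrightarrow> e \<subseteq> V" "\<And>e. e \<in> E \<Longrightarrow> card e = 2"
    using assms(2) by (auto simp: simple_graph_def)
  have fE: "finite E" using V finite_subset[of E "Pow V"] by auto
  have iE: "induced E V = E" using V by (auto simp: induced_def)
  have "real ((k - 1) * card V) < real (2 * card E)" using assms by (simp add: of_nat_diff)
  then have dense: "(k - 1) * card V < 2 * card E" by (simp only: of_nat_less_iff)
  have "V \<noteq> {}"
  proof
    assume "V = {}"
    then have "E = {}" using V by fastforce
    then show False using dense by simp
  qed
  then obtain U where U: "U \<noteq> {}" "U \<subseteq> V"
    and deg: "\<And>u. u \<in> U \<Longrightarrow> k - 1 < 2 * card (nbrs E U u)"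
    and cut: "\<And>D z. D \<subseteq> U \<Longrightarrow> D \<noteq> {} \<Longrightarrow> \<not> U \<subseteq> insert z D \<Longrightarrow> \<exists>u\<in>D. \<exists>w\<in>U - D - {z}. {u, w} \<in> E"
    and heavy: "\<exists>v\<in>U. k - 1 \<le> card (nbrs E U v)"
    using minimal_dense_subset[OF V(1) fE V(3), of "k - 1"] dense iE by (metis trans_less_add1)
  obtain v where v: "v \<in> U" "k - 1 \<le> card (nbrs E U v)" using heavy by blast
  define R where "R = (\<lambda>x y. x \<in> U \<and> y \<in> U \<and> {x, y} \<in> E)"
  have nbR: "{w. R u w} = nbrs E U u" for u by (auto simp: R_def nbrs_def)
  have symR: "symp R" by (auto simp: R_def symp_def insert_commute)
  have irrR: "irreflp R" using V(3) by (fastforce simp: R_def irreflp_def)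
  have fU: "finite U" using U V finite_subset by blast
  have "\<exists>c. cyc R c \<and> hd c = v \<and> k \<le> length c"
  proof (rule long_cycle_through)
    show "\<exists>u\<in>D. \<exists>w\<in>U - D - {z}. R u w" if "D \<subseteq> U" "D \<noteq> {}" "\<not> U \<subseteq> insert z D" for D z
      using cut[OF that] that by (auto simp: R_def)
    show "k \<le> 2 * card {w. R u w}" if "u \<in> U" for u using deg[OF that] nbR by simp
    show "k \<le> card {w. R v w} + 1" using v nbR by simp
  qed (use fU v symR irrR assms(1) in \<open>auto simp: R_def\<close>)
  then obtain c where c: "cyc R c" "hd c = v" "k - r \<le> length c" by auto
  have fin: "finite {w. R v w}" using fU by (auto simp: R_def)
  \<comment> \<open>The target length is \<open>k - r\<close>, since the \<open>r\<close> pendant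
    edges bring the size to \<open>k\<close>. As \<open>v\<close> has at least \<open>k - 1\<close>
    neighbours, at least \<open>r\<close> of them lie off \<open>c'\<close>.\<close>
  obtain c' where c': "cyc R c'" "hd c' = v" "k - r \<le> length c'"
    "card {w. R v w} + 1 \<le> k - r + card ({w. R v w} - set c')"
    by (rule short_chord_cycle[OF c _ symR irrR fin]) (use assms(1) in auto)
  have "r \<le> card ({w. R v w} - set c')" using c'(4) v(2) nbR assms(1) by simp
  then obtain L where L: "L \<subseteq> {w. R v w} - set c'" "card L = r" "finite L"
    using obtain_subset_with_card_n by metis
  have "\<exists>V' E'. subgraph V' E' V E \<and> is_keyring (card L) V' E' \<and> card E' = length c' + card L"
    by (rule keyring_of_cyc[OF c'(1,2)]) (use L irrR U in \<open>auto simp: R_def\<close>)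
  then show ?thesis using L(2) c'(3) by fastforce
qed

end
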